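(* Let $m\ge 3$, $V=\mathbb{F}_2^m$, and $C=RM(1,m)\subseteq\mathbb{F}_2^V$, with dual $C^\perp$. Let $U\subset V$ be a three-dimensional subspace, and let $H_8=\{c|_U\mid c\in C\}\subseteq \mathbb{F}_2^U$ (the code of affine linear functions on $U$, an extended Hamming code of length $8$). Let $k$ be a positive integer and let $f$ be a harmonic function of degree $k$ on the coordinate set $V$ such that $f(z)=0$ for every $k$-subset $z$ of $V$ not contained in $U$. Then \[ w_{C,f}(x,y)=2^{m-3}x^{2^{m-1}}y^{2^{m-1}}\sum_{a\in H_8,\ \mathrm{wt}(a)=4}\widetilde{f}(a), \] \[ w_{C^\perp,f}(x,y)=(-1)^k(xy)^k\, 2^{2^{m-1}-4}\left(\frac{x+y}{\sqrt{2}}\right)^{2^{m-1}-k}\left(\frac{x-y}{\sqrt{2}}\right)^{2^{m-1}-k}\sum_{a\in H_8,\ \mathrm{wt}(a)=4}\widetilde{f}(a), \] where for $a\in H_8$, $\widetilde{f}(a)$ means $\widetilde f$ evaluated at $\mathrm{supp}(a)\subseteq U\subseteq V$.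
   Context: $RM(1,m)=\{(\lambda(x)+b)_{x\in V}\mid \lambda\in \mathrm{Hom}(V,\mathbb{F}_2),\ b\in\mathbb{F}_2\}$, with coordinates indexed by $V$; $c|_U=(c_x)_{x\in U}$; $\mathrm{wt}$ is the Hamming weight and $\mathrm{supp}(c)$ the set of coordinates where $c$ is nonzero. Let $X$ be the set of all subsets of $V$ and $X_k$ the set of $k$-subsets; $\mathbb{R}X_k$ is the real vector space with basis $X_k$, whose elements $f=\sum_{z\in X_k}f(z)z$ are identified with functions $X_k\to\mathbb{R}$. For $f\in\mathbb{R}X_k$ define $\widetilde f(u)=\sum_{z\in X_k,\,z\subseteq u}f(z)$ for $u\in X$. The linear map $\gamma$ on $\mathbb{R}X$ is defined by $\gamma(z)=\sum_{y\in X_{k-1},\,y\subseteq z}y$ for $z\in X_k$. A harmonic function of degree $k$ is an $f\in\mathbb{R}X_k$ with $\gamma(f)=0$. For a binary code $D$ of length $n$ with coordinates $V$, the harmonic weight enumerator is $w_{D,f}(x,y)=\sum_{c\in D}\widetilde f(\mathrm{supp}(c))x^{n-\mathrm{wt}(c)}y^{\mathrm{wt}(c)}$. *)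

theory Defs
  imports
    "HOL-Analysis.Cartesian_Space"
    "HOL-Library.Z2"
    "HOL-Library.FuncSet"
    "HOL-Computational_Algebra.Polynomial"
begin

instance bit :: finite
proof
  have "(UNIV :: bit set) = {0, 1}"
    by (auto intro: bit.exhaust)
  then show "finite (UNIV :: bit set)"
    by (metis finite.emptyI finite.insertI)
qed

text \<open>
  The coordinate set \<open>V\<close> is a finite type \<open>'v\<close>, a word of length \<open>CARD('v)\<close> is a function
  \<open>'v \<Rightarrow> bit\<close>, and a word with coordinates in a subset \<open>A\<close> is such a function that is
  \<open>extensional\<close> on \<open>A\<close>. Since values outside \<open>A\<close> are then meaningless, \<open>supp\<close> and \<open>wt\<close>
  take the coordinate set as an argument.
\<close>

definition supp :: "'v set \<Rightarrow> ('v \<Rightarrow> bit) \<Rightarrow> 'v set"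
  where "supp A c = {x \<in> A. c x \<noteq> 0}"

definition wt :: "'v set \<Rightarrow> ('v \<Rightarrow> bit) \<Rightarrow> nat"
  where "wt A c = card (supp A c)"

definition dual_code :: "('v::finite \<Rightarrow> bit) set \<Rightarrow> ('v \<Rightarrow> bit) set"
  where "dual_code D = {d. \<forall>c\<in>D. (\<Sum>x\<in>UNIV. c x * d x) = 0}"

definition restrict_code :: "'v set \<Rightarrow> ('v \<Rightarrow> bit) set \<Rightarrow> ('v \<Rightarrow> bit) set"
  where "restrict_code U D = {restrict c U | c. c \<in> D}"

text \<open>\<open>RM(1,m)\<close> with \<open>m = CARD('m)\<close>.\<close>

definition RM1 :: "(bit ^ 'm \<Rightarrow> bit) set"
  where "RM1 = {(\<lambda>x. l x + b) | l b. Vector_Spaces.linear (*s) (*) l}"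

text \<open>
  Elements of \<open>\<real>X\<close> are functions \<open>'v set \<Rightarrow> real\<close>; \<open>RX k\<close> is the subspace spanned by the
  \<open>k\<close>-subsets.
\<close>

definition ksubsets :: "nat \<Rightarrow> 'v::finite set set"
  where "ksubsets k = {z. card z = k}"

definition RX :: "nat \<Rightarrow> ('v::finite set \<Rightarrow> real) set"
  where "RX k = {f. \<forall>z. z \<notin> ksubsets k \<longrightarrow> f z = 0}"

definition ftilde :: "nat \<Rightarrow> ('v::finite set \<Rightarrow> real) \<Rightarrow> 'v set \<Rightarrow> real"
  where "ftilde k f u = (\<Sum>z \<in> {z \<in> ksubsets k. z \<subseteq> u}. f z)"

text \<open>\<open>gamma_basis z\<close> is \<open>\<gamma>(z)\<close> for a basis element \<open>z\<close>; in particular \<open>\<gamma>(\<emptyset>) = 0\<close>.\<close>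

definition gamma_basis :: "'v::finite set \<Rightarrow> ('v set \<Rightarrow> real)"
  where "gamma_basis z = (\<lambda>y. if y \<subseteq> z \<and> card y + 1 = card z then 1 else 0)"

definition gamma :: "('v::finite set \<Rightarrow> real) \<Rightarrow> ('v set \<Rightarrow> real)"
  where "gamma f = (\<lambda>y. \<Sum>z\<in>UNIV. f z * gamma_basis z y)"

definition harmonic :: "nat \<Rightarrow> ('v::finite set \<Rightarrow> real) \<Rightarrow> bool"
  where "harmonic k f \<longleftrightarrow> f \<in> RX k \<and> gamma f = (\<lambda>_. 0)"

text \<open>The polynomial ring \<open>\<real>[x,y]\<close> is \<open>real poly poly\<close>, i.e. \<open>\<real>[y][x]\<close>.\<close>

definition const_xy :: "real \<Rightarrow> real poly poly"
  where "const_xy a = [:[:a:]:]"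

definition var_x :: "real poly poly"
  where "var_x = [:0, 1:]"

definition var_y :: "real poly poly"
  where "var_y = [:[:0, 1:]:]"

definition harmonic_weight_enum ::
    "('v::finite \<Rightarrow> bit) set \<Rightarrow> nat \<Rightarrow> ('v set \<Rightarrow> real) \<Rightarrow> real poly poly"
  where "harmonic_weight_enum D k f =
    (\<Sum>c\<in>D. const_xy (ftilde k f (supp UNIV c)) *
        var_x ^ (CARD('v) - wt UNIV c) * var_y ^ wt UNIV c)"

end

theory Submission
  imports Defs
begin

text \<open>
  A function \<open>f\<close> is harmonic of degree \<open>k\<close> exactly when the multilinear form
  \<open>F(a) = \<Sum>\<^sub>z f(z) \<Prod>\<^sub>i\<^sub>\<in>\<^sub>z a\<^sub>i\<close> is invariant under the translations \<open>a\<^sub>i \<mapsto> a\<^sub>i + t\<close>. Applied to the Fourier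
  transform of \<open>v \<mapsto> f~(supp v) x\<^bsup>n - wt v\<^esup> y\<^bsup>wt v\<^esup>\<close>, this invariance turns Poisson summation over a
  linear code into the MacWilliams identity for harmonic weight enumerators, here multiplied by
  \<open>(x\<^sup>2 - y\<^sup>2)\<^sup>k\<close> so that it holds in the polynomial ring. A nonconstant affine function on \<open>V\<close> has
  weight \<open>2\<^bsup>m-1\<^esup>\<close>, the constant ones contribute nothing because \<open>f~\<close> vanishes at \<open>\<emptyset>\<close> and \<open>V\<close>, and
  every word of \<open>H\<^sub>8\<close> is the restriction of \<open>2\<^bsup>m-3\<^esup>\<close> words of \<open>C\<close>. This gives the first formula, and
  the MacWilliams identity the second.
\<close>

section \<open>Arithmetic in the two-element field, kept in ring notation\<close>

declare add_bit_eq_xor [simp del] mult_bit_eq_and [simp del]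
  minus_bit_def [simp del] uminus_bit_def [simp del]

lemma bit_add_self [simp]: "a + a = (0 :: bit)"
  by (cases a) simp_all

lemma bit_add_self_left [simp]: "a + (a + b) = (b :: bit)"
  by (simp add: add.assoc[symmetric])

section \<open>Harmonic functions\<close>

text \<open>Downward induction on \<open>card y\<close>. At \<open>card y = k - 1\<close> this is
  the coefficient of \<open>gamma f\<close> at \<open>y\<close>. Below that, each
  \<open>k\<close>-set containing \<open>y\<close> contains \<open>k - card y\<close> of the sets
  \<open>insert i y\<close>, so a double count reduces the sum to those for the sets
  \<open>insert i y\<close>, and the positive factor \<open>k - card y\<close> cancels.\<close>

lemma sum_supersets_harmonic:
  assumes h: "harmonic k f" and "card y < k"
  shows "(\<Sum>z | y \<subseteq> z. f z) = 0"
  using assms(2)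
proof (induction "k - card y" arbitrary: y rule: less_induct)
  case less
  have supp: "f z = 0" if "card z \<noteq> k" for z
    using h that by (auto simp: harmonic_def RX_def ksubsets_def)
  show ?case
  proof (cases "card y + 1 = k")
    case True
    have "0 = gamma f y"
      using h by (simp add: harmonic_def)
    also have "\<dots> = (\<Sum>z\<in>UNIV. if y \<subseteq> z then f z else 0)"
      unfolding gamma_def gamma_basis_def using True supp
      by (intro sum.cong) auto
    also have "\<dots> = (\<Sum>z | y \<subseteq> z. f z)"
      by (simp add: sum.If_cases)
    finally show ?thesis by simp
  next
    case False
    have "real (k - card y) * (\<Sum>z | y \<subseteq> z. f z) = (\<Sum>z | y \<subseteq> z. \<Sum>i | i \<in> z - y. f z)"
      unfolding sum_distrib_left
    proof (intro sum.cong refl)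
      fix z assume "z \<in> {z. y \<subseteq> z}"
      then have "card (z - y) = card z - card y"
        by (simp add: card_Diff_subset)
      then show "real (k - card y) * f z = (\<Sum>i | i \<in> z - y. f z)"
        using supp[of z] by (cases "card z = k") (auto simp: set_diff_eq)
    qed
    also have "\<dots> = (\<Sum>i\<in>-y. \<Sum>z | insert i y \<subseteq> z. f z)"
      using sum.swap_restrict[of "{z. y \<subseteq> z}" "-y" "\<lambda>z i. f z" "\<lambda>z i. i \<in> z"]
      by (simp add: conj_commute)
    also have "\<dots> = 0"
    proof (rule sum.neutral, rule ballI)
      fix i assume "i \<in> -y"
      then have "card (insert i y) = Suc (card y)" by simp
      then show "(\<Sum>z | insert i y \<subseteq> z. f z) = 0"
        using False less.prems by (intro less.hyps) auto
    qed
    finally show ?thesis using less.prems by simp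
  qed
qed

text \<open>After expansion of the products, the coefficient of the monomial of \<open>y\<close> is
  \<open>t ^ (k - card y)\<close> times the sum of \<open>h\<close> over the supersets of
  \<open>y\<close>. That sum is zero for \<open>card y < k\<close>, so only monomials of degree
  \<open>k\<close> survive, and they do not involve \<open>t\<close>.\<close>

lemma multilinear_form_translation:
  fixes h :: "'v::finite set \<Rightarrow> 'r::comm_ring_1"
  assumes supp: "\<And>z. card z \<noteq> k \<Longrightarrow> h z = 0"
    and null: "\<And>y. card y < k \<Longrightarrow> (\<Sum>z | y \<subseteq> z. h z) = 0"
  shows "(\<Sum>z\<in>UNIV. h z * (\<Prod>i\<in>z. a i + t)) = (\<Sum>z\<in>UNIV. h z * (\<Prod>i\<in>z. a i))"
proof -
  have "(\<Sum>z\<in>UNIV. h z * (\<Prod>i\<in>z. a i + t))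
      = (\<Sum>z\<in>UNIV. \<Sum>y | y \<in> UNIV \<and> y \<subseteq> z. h z * ((\<Prod>i\<in>y. a i) * t ^ card (z - y)))"
    by (simp add: prod_add sum_distrib_left Pow_def)
  also have "\<dots> = (\<Sum>y\<in>UNIV. \<Sum>z | z \<in> UNIV \<and> y \<subseteq> z. h z * ((\<Prod>i\<in>y. a i) * t ^ card (z - y)))"
    using sum.swap_restrict[of UNIV UNIV
        "\<lambda>z y. h z * ((\<Prod>i\<in>y. a i) * t ^ card (z - y))" "\<lambda>z y. y \<subseteq> z"] by simp
  also have "\<dots> = (\<Sum>y\<in>UNIV. h y * (\<Prod>i\<in>y. a i))"
  proof (intro sum.cong refl)
    fix y :: "'v set"
    have "(\<Sum>z | y \<subseteq> z. h z * ((\<Prod>i\<in>y. a i) * t ^ card (z - y)))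
        = (\<Sum>z | y \<subseteq> z. h z * ((\<Prod>i\<in>y. a i) * t ^ (k - card y)))"
    proof (intro sum.cong refl)
      fix z assume "z \<in> {z. y \<subseteq> z}"
      then show "h z * ((\<Prod>i\<in>y. a i) * t ^ card (z - y))
          = h z * ((\<Prod>i\<in>y. a i) * t ^ (k - card y))"
        using supp[of z] by (cases "card z = k") (auto simp: card_Diff_subset)
    qed
    also have "\<dots> = (\<Sum>z | y \<subseteq> z. h z) * ((\<Prod>i\<in>y. a i) * t ^ (k - card y))"
      by (simp add: sum_distrib_right)
    also have "\<dots> = h y * (\<Prod>i\<in>y. a i)"
    proof (cases "card y < k")
      case True
      then show ?thesis using null supp by simp
    next
      \<comment> \<open>Here the truncated difference \<open>k - card y\<close> is 0, so the power
        of \<open>t\<close> is 1; for \<open>card y > k\<close> both sides are zero.\<close>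
      case False
      have "(\<Sum>z | y \<subseteq> z. h z) = (\<Sum>z\<in>{y}. h z)"
      proof (intro sum.mono_neutral_right)
        show "\<forall>z\<in>{z. y \<subseteq> z} - {y}. h z = 0"
        proof
          fix z assume "z \<in> {z. y \<subseteq> z} - {y}"
          then have "card y < card z" by (intro psubset_card_mono) auto
          then show "h z = 0" using False supp by simp
        qed
      qed auto
      then show ?thesis using False by simp
    qed
    finally show "(\<Sum>z | z \<in> UNIV \<and> y \<subseteq> z. h z * ((\<Prod>i\<in>y. a i) * t ^ card (z - y)))
        = h y * (\<Prod>i\<in>y. a i)" by simp
  qed
  finally show ?thesis .
qed

section \<open>Values of \<open>ftilde\<close> on extreme sets and on intersections\<close>

lemma ftilde_eq_sum_Pow:
  assumes "harmonic k f"
  shows "ftilde k f u = (\<Sum>z\<in>Pow u. f z)"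
  unfolding ftilde_def using assms
  by (intro sum.mono_neutral_left) (auto simp: harmonic_def RX_def)

lemma ftilde_empty:
  assumes "k > 0"
  shows "ftilde k f {} = 0"
proof -
  have "{z \<in> ksubsets k. z \<subseteq> {}} = {}"
    using assms by (auto simp: ksubsets_def)
  then show ?thesis unfolding ftilde_def by (metis sum.empty)
qed

lemma ftilde_UNIV:
  assumes "harmonic k f" "k > 0"
  shows "ftilde k f UNIV = 0"
  using sum_supersets_harmonic[OF assms(1), of "{}"] assms
  by (simp add: ftilde_eq_sum_Pow)

text \<open>Settles the degrees \<open>k\<close> above half the length, where no word of that weight
  can contain a \<open>k\<close>-set.\<close>

lemma ftilde_card_less:
  assumes "card u < k"
  shows "ftilde k f u = 0"
proof -
  have "{z \<in> ksubsets k. z \<subseteq> u} = {}"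
    using assms by (auto simp: ksubsets_def dest: card_mono[rotated])
  then show ?thesis unfolding ftilde_def by (metis sum.empty)
qed

text \<open>Lets a word on the whole space be replaced by its restriction to
  \<open>U\<close>.\<close>

lemma ftilde_inter:
  assumes "\<And>z. z \<in> ksubsets k \<Longrightarrow> \<not> z \<subseteq> U \<Longrightarrow> f z = 0"
  shows "ftilde k f (u \<inter> U) = ftilde k f u"
  unfolding ftilde_def using assms
  by (intro sum.mono_neutral_left) auto

section \<open>The MacWilliams identity for harmonic weight enumerators\<close>

text \<open>The sign character of the additive group of \<open>bit\<close>, valued in an arbitrary
  commutative ring so that polynomials can serve as values.\<close>

definition bit_sign :: "bit \<Rightarrow> 'r::comm_ring_1"
  where "bit_sign b = (if b = 0 then 1 else - 1)"

lemma bit_sign_0 [simp]: "bit_sign 0 = 1"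
  by (simp add: bit_sign_def)

lemma bit_sign_1 [simp]: "bit_sign 1 = - 1"
  by (simp add: bit_sign_def)

lemma bit_sign_add: "bit_sign (a + b) = bit_sign a * bit_sign b"
  by (cases a; cases b) simp_all

lemma bit_sign_sum: "bit_sign (\<Sum>i\<in>A. g i) = (\<Prod>i\<in>A. bit_sign (g i))"
  by (induction A rule: infinite_finite_induct) (simp_all add: bit_sign_add)

text \<open>Orthogonality of characters: the character sum over \<open>D\<close> at \<open>v\<close>
  is \<open>card D\<close> if \<open>v\<close> lies in the dual. Otherwise some \<open>e\<close> in
  \<open>D\<close> has inner product 1 with \<open>v\<close>, and translating \<open>D\<close> by
  \<open>e\<close> turns the sum into its negative, which forces zero in characteristic 0.\<close>

lemma poisson_summation_dual_code:
  fixes D :: "('v::finite \<Rightarrow> bit) set" and g :: "('v \<Rightarrow> bit) \<Rightarrow> 'r::{idom,ring_char_0}"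
  assumes add: "\<And>c d. c \<in> D \<Longrightarrow> d \<in> D \<Longrightarrow> (\<lambda>x. c x + d x) \<in> D"
  shows "of_nat (card D) * (\<Sum>d\<in>dual_code D. g d)
    = (\<Sum>c\<in>D. \<Sum>v\<in>UNIV. bit_sign (\<Sum>x\<in>UNIV. c x * v x) * g v)"
proof -
  have char_sum: "(\<Sum>c\<in>D. bit_sign (\<Sum>x\<in>UNIV. c x * v x))
      = (if v \<in> dual_code D then of_nat (card D) else 0 :: 'r)" for v
  proof (cases "v \<in> dual_code D")
    case True
    then show ?thesis by (simp add: dual_code_def)
  next
    case False
    then obtain e where e: "e \<in> D" "(\<Sum>x\<in>UNIV. e x * v x) = 1"
      by (auto simp: dual_code_def)
    let ?S = "\<Sum>c\<in>D. bit_sign (\<Sum>x\<in>UNIV. c x * v x) :: 'r"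
    have cancel: "(\<lambda>x. e x + (e x + c x)) = c" for c
      by simp
    have "?S = (\<Sum>c\<in>D. bit_sign (\<Sum>x\<in>UNIV. (e x + c x) * v x))"
      by (rule sum.reindex_bij_witness[where i = "\<lambda>c x. e x + c x" and j = "\<lambda>c x. e x + c x"])
        (use add e in \<open>simp_all add: cancel\<close>)
    also have "\<dots> = - ?S"
      by (simp add: distrib_right sum.distrib bit_sign_add e sum_negf)
    finally show ?thesis using False by simp
  qed
  have "(\<Sum>c\<in>D. \<Sum>v\<in>UNIV. bit_sign (\<Sum>x\<in>UNIV. c x * v x) * g v)
      = (\<Sum>v\<in>UNIV. (\<Sum>c\<in>D. bit_sign (\<Sum>x\<in>UNIV. c x * v x)) * g v)"
    by (subst sum.swap) (simp add: sum_distrib_right)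
  also have "\<dots> = (\<Sum>v\<in>UNIV. if v \<in> dual_code D then of_nat (card D) * g v else 0)"
    by (intro sum.cong) (simp_all add: char_sum)
  also have "\<dots> = of_nat (card D) * (\<Sum>d\<in>dual_code D. g d)"
    by (simp add: sum.If_cases sum_distrib_left)
  finally show ?thesis ..
qed

lemma bij_betw_supp: "bij_betw (supp UNIV) (UNIV :: ('v \<Rightarrow> bit) set) UNIV"
  by (rule bij_betwI[where g = "\<lambda>S x. if x \<in> S then 1 else 0"])
    (auto simp: supp_def fun_eq_iff)

text \<open>The Fourier transform at \<open>c\<close> of the summand of the weight enumerator. Words
  are replaced by their supports \<open>S\<close>; with \<open>z\<close> fixed, the sum over all
  \<open>S\<close> containing \<open>z\<close> factors, since a point of \<open>z\<close> must lie
  in \<open>S\<close> while any other point is free to contribute \<open>Y\<close> with its sign or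
  \<open>X\<close>.\<close>

lemma signed_transform:
  fixes h :: "'v::finite set \<Rightarrow> 'r::comm_ring_1"
  shows "(\<Sum>v\<in>UNIV. bit_sign (\<Sum>x\<in>UNIV. c x * v x) *
      ((\<Sum>z\<in>Pow (supp UNIV v). h z) * X ^ (CARD('v) - wt UNIV v) * Y ^ wt UNIV v))
    = (\<Sum>z\<in>UNIV. h z * ((\<Prod>i\<in>z. bit_sign (c i) * Y) * (\<Prod>i\<in>-z. bit_sign (c i) * Y + X)))"
    (is "?L = ?R")
proof -
  let ?p = "\<lambda>S. \<Prod>i\<in>S. bit_sign (c i) * Y"
  have "?L = (\<Sum>v\<in>UNIV. (\<lambda>S. (\<Sum>z\<in>Pow S. h z) * (?p S * X ^ card (- S))) (supp UNIV v))"
  proof (intro sum.cong refl)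
    fix v :: "'v \<Rightarrow> bit"
    have "bit_sign (\<Sum>x\<in>UNIV. c x * v x) = (\<Prod>x\<in>UNIV. bit_sign (c x * v x) :: 'r)"
      by (rule bit_sign_sum)
    also have "\<dots> = (\<Prod>x\<in>supp UNIV v. bit_sign (c x * v x))"
      by (intro prod.mono_neutral_right) (auto simp: supp_def)
    also have "\<dots> = (\<Prod>x\<in>supp UNIV v. bit_sign (c x))"
      by (intro prod.cong) (auto simp: supp_def)
    finally have "bit_sign (\<Sum>x\<in>UNIV. c x * v x) = (\<Prod>x\<in>supp UNIV v. bit_sign (c x) :: 'r)" .
    then show "bit_sign (\<Sum>x\<in>UNIV. c x * v x) *
        ((\<Sum>z\<in>Pow (supp UNIV v). h z) * X ^ (CARD('v) - wt UNIV v) * Y ^ wt UNIV v)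
      = (\<lambda>S. (\<Sum>z\<in>Pow S. h z) * (?p S * X ^ card (- S))) (supp UNIV v)"
      by (simp add: wt_def prod.distrib Compl_eq_Diff_UNIV card_Diff_subset ac_simps)
  qed
  also have "\<dots> = (\<Sum>S\<in>UNIV. (\<Sum>z\<in>Pow S. h z) * (?p S * X ^ card (- S)))"
    by (rule sum.reindex_bij_betw[OF bij_betw_supp])
  also have "\<dots> = (\<Sum>S\<in>UNIV. \<Sum>z | z \<in> UNIV \<and> z \<subseteq> S. h z * (?p S * X ^ card (- S)))"
    by (simp add: sum_distrib_right Pow_def)
  also have "\<dots> = (\<Sum>z\<in>UNIV. \<Sum>S | S \<in> UNIV \<and> z \<subseteq> S. h z * (?p S * X ^ card (- S)))"
    by (rule sum.swap_restrict) simp_all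
  also have "\<dots> = ?R"
  proof (intro sum.cong refl)
    fix z :: "'v set"
    have "(\<Sum>S | z \<subseteq> S. ?p S * X ^ card (- S)) = (\<Sum>T\<in>Pow (-z). ?p z * (?p T * X ^ card (- z - T)))"
    proof (rule sum.reindex_bij_witness[where i = "\<lambda>T. z \<union> T" and j = "\<lambda>S. S - z"])
      fix S assume "S \<in> {S. z \<subseteq> S}"
      then have S: "z \<subseteq> S" by simp
      then show "z \<union> (S - z) = S" "S - z \<in> Pow (- z)" by auto
      have "?p S = ?p z * ?p (S - z)"
        using S by (subst prod.subset_diff[of z S]) (simp_all add: mult.commute)
      moreover have "- z - (S - z) = - S" using S by auto
      ultimately show "?p z * (?p (S - z) * X ^ card (- z - (S - z))) = ?p S * X ^ card (- S)"
        by (simp add: mult.assoc)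
    qed auto
    also have "\<dots> = ?p z * (\<Prod>i\<in>-z. bit_sign (c i) * Y + X)"
      by (simp add: prod_add sum_distrib_left)
    finally show "(\<Sum>S | S \<in> UNIV \<and> z \<subseteq> S. h z * (?p S * X ^ card (- S)))
        = h z * (?p z * (\<Prod>i\<in>-z. bit_sign (c i) * Y + X))"
      by (simp add: sum_distrib_left[symmetric])
  qed
  finally show ?thesis .
qed

text \<open>
  Multiplying by \<open>(X\<^sup>2 - Y\<^sup>2)\<^sup>k\<close> completes the product over the complement of \<open>z\<close> to the whole
  coordinate set; the remaining factors \<open>s\<^sub>i Y (X - s\<^sub>i Y) = X Y s\<^sub>i - Y\<^sup>2\<close> are, up to a translation,
  \<open>X Y (s\<^sub>i - 1)\<close>.
\<close>

lemma signed_transform_harmonic: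
  fixes h :: "'v::finite set \<Rightarrow> 'r::comm_ring_1" and c :: "'v \<Rightarrow> bit"
  assumes supp: "\<And>z. card z \<noteq> k \<Longrightarrow> h z = 0"
    and null: "\<And>y. card y < k \<Longrightarrow> (\<Sum>z | y \<subseteq> z. h z) = 0"
  shows "((X + Y) * (X - Y)) ^ k *
      (\<Sum>z\<in>UNIV. h z * ((\<Prod>i\<in>z. bit_sign (c i) * Y) * (\<Prod>i\<in>-z. bit_sign (c i) * Y + X)))
    = (- 2 * X * Y) ^ k * (\<Sum>z\<in>Pow (supp UNIV c). h z) *
      (X + Y) ^ (CARD('v) - wt UNIV c) * (X - Y) ^ wt UNIV c"
proof -
  define s :: "'v \<Rightarrow> 'r" where "s i = bit_sign (c i)" for i
  define P where "P = (\<Prod>i\<in>UNIV. s i * Y + X)"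
  have P: "P = (X + Y) ^ (CARD('v) - wt UNIV c) * (X - Y) ^ wt UNIV c"
  proof -
    have "P = (\<Prod>i\<in>supp UNIV c. s i * Y + X) * (\<Prod>i\<in>-supp UNIV c. s i * Y + X)"
      unfolding P_def
      by (subst prod.union_disjoint[symmetric]) (auto intro: prod.cong)
    also have "(\<Prod>i\<in>supp UNIV c. s i * Y + X) = (\<Prod>i\<in>supp UNIV c. X - Y)"
      by (intro prod.cong) (auto simp: s_def supp_def)
    also have "(\<Prod>i\<in>-supp UNIV c. s i * Y + X) = (\<Prod>i\<in>-supp UNIV c. X + Y)"
      by (intro prod.cong) (auto simp: s_def supp_def add.commute)
    finally show ?thesis by (simp add: wt_def Compl_eq_Diff_UNIV card_Diff_subset mult.commute)
  qed
  have sq: "(s i * Y + X) * (X - s i * Y) = (X + Y) * (X - Y)" for i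
    by (cases "c i") (simp_all add: s_def algebra_simps)
  have split: "s i * Y * (X - s i * Y) = X * Y * (s i - 1) + (X * Y - Y * Y)" for i
    by (cases "c i") (simp_all add: s_def algebra_simps)
  have "((X + Y) * (X - Y)) ^ k * (\<Sum>z\<in>UNIV. h z * ((\<Prod>i\<in>z. s i * Y) * (\<Prod>i\<in>-z. s i * Y + X)))
      = P * (\<Sum>z\<in>UNIV. h z * (\<Prod>i\<in>z. X * Y * (s i - 1) + (X * Y - Y * Y)))"
    unfolding sum_distrib_left
  proof (intro sum.cong refl)
    fix z :: "'v set"
    have "((X + Y) * (X - Y)) ^ card z * ((\<Prod>i\<in>z. s i * Y) * (\<Prod>i\<in>-z. s i * Y + X))
        = ((\<Prod>i\<in>z. s i * Y + X) * (\<Prod>i\<in>-z. s i * Y + X)) *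
          ((\<Prod>i\<in>z. s i * Y) * (\<Prod>i\<in>z. X - s i * Y))"
    proof -
      have "((X + Y) * (X - Y)) ^ card z = (\<Prod>i\<in>z. (s i * Y + X) * (X - s i * Y))"
        by (simp add: sq)
      then show ?thesis by (simp add: prod.distrib ac_simps)
    qed
    also have "(\<Prod>i\<in>z. s i * Y + X) * (\<Prod>i\<in>-z. s i * Y + X) = P"
      unfolding P_def
      by (subst prod.union_disjoint[symmetric]) (auto intro: prod.cong)
    also have "(\<Prod>i\<in>z. s i * Y) * (\<Prod>i\<in>z. X - s i * Y)
        = (\<Prod>i\<in>z. X * Y * (s i - 1) + (X * Y - Y * Y))"
      by (simp add: prod.distrib[symmetric] split)
    finally show "((X + Y) * (X - Y)) ^ k * (h z * ((\<Prod>i\<in>z. s i * Y) * (\<Prod>i\<in>-z. s i * Y + X)))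
        = P * (h z * (\<Prod>i\<in>z. X * Y * (s i - 1) + (X * Y - Y * Y)))"
      using supp[of z] by (cases "card z = k") (simp_all add: mult.left_commute)
  qed
  also have "(\<Sum>z\<in>UNIV. h z * (\<Prod>i\<in>z. X * Y * (s i - 1) + (X * Y - Y * Y)))
      = (\<Sum>z\<in>UNIV. h z * (\<Prod>i\<in>z. X * Y * (s i - 1)))"
    by (rule multilinear_form_translation[OF supp null])
  \<comment> \<open>\<open>s i - 1\<close> is 0 off the support of \<open>c\<close> and -2 on it, so
    only subsets of the support remain, each with the factor
    \<open>(- 2 * X * Y) ^ k\<close>.\<close>
  also have "\<dots> = (\<Sum>z\<in>Pow (supp UNIV c). h z * (\<Prod>i\<in>z. X * Y * (s i - 1)))"
  proof (rule sum.mono_neutral_right; (simp; fail)?)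
    show "\<forall>z\<in>UNIV - Pow (supp UNIV c). h z * (\<Prod>i\<in>z. X * Y * (s i - 1)) = 0"
    proof
      fix z assume "z \<in> UNIV - Pow (supp UNIV c)"
      then obtain i where "i \<in> z" "i \<notin> supp UNIV c" by blast
      then have "(\<Prod>i\<in>z. X * Y * (s i - 1)) = 0"
        by (intro prod_zero bexI[of _ i]) (auto simp: s_def supp_def)
      then show "h z * (\<Prod>i\<in>z. X * Y * (s i - 1)) = 0" by simp
    qed
  qed
  also have "\<dots> = (\<Sum>z\<in>Pow (supp UNIV c). h z * (- 2 * X * Y) ^ k)"
  proof (intro sum.cong refl)
    fix z assume "z \<in> Pow (supp UNIV c)"
    then have "(\<Prod>i\<in>z. X * Y * (s i - 1)) = (\<Prod>i\<in>z. - 2 * X * Y)"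
      by (intro prod.cong) (auto simp: s_def supp_def)
    then show "h z * (\<Prod>i\<in>z. X * Y * (s i - 1)) = h z * (- 2 * X * Y) ^ k"
      using supp[of z] by (cases "card z = k") simp_all
  qed
  also have "\<dots> = (- 2 * X * Y) ^ k * (\<Sum>z\<in>Pow (supp UNIV c). h z)"
    by (subst mult.commute) (rule sum_distrib_right[symmetric])
  finally show ?thesis
    unfolding s_def[symmetric] by (simp add: P mult.assoc mult.left_commute)
qed

section \<open>The embedding of the reals into \<real>[x,y]\<close>

lemma const_xy_0 [simp]: "const_xy 0 = 0"
  by (simp add: const_xy_def)

lemma const_xy_1 [simp]: "const_xy 1 = 1"
  by (simp add: const_xy_def one_pCons)

lemma const_xy_add: "const_xy (a + b) = const_xy a + const_xy b"
  by (simp add: const_xy_def)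

lemma const_xy_mult: "const_xy (a * b) = const_xy a * const_xy b"
  by (simp add: const_xy_def)

lemma const_xy_sum: "const_xy (\<Sum>i\<in>A. g i) = (\<Sum>i\<in>A. const_xy (g i))"
  by (induction A rule: infinite_finite_induct) (simp_all add: const_xy_add)

lemma const_xy_numeral: "const_xy (numeral n) = numeral n"
  by (simp add: const_xy_def numeral_poly)

lemma const_xy_power: "const_xy (a ^ n) = const_xy a ^ n"
  by (induction n) (simp_all add: const_xy_mult)

text \<open>Cleared of denominators, this is Bachoc's identity: the enumerator of the dual is that
  of \<open>D\<close> at \<open>(x + y, x - y)\<close>, times
  \<open>(- 2 x y / (x^2 - y^2)) ^ k / card D\<close>. Poisson summation reduces it to the
  transforms at each \<open>c\<close>.\<close>

theorem macwilliams_harmonic: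
  fixes D :: "('v::finite \<Rightarrow> bit) set"
  assumes add: "\<And>c d. c \<in> D \<Longrightarrow> d \<in> D \<Longrightarrow> (\<lambda>x. c x + d x) \<in> D"
    and h: "harmonic k f"
  shows "((var_x + var_y) * (var_x - var_y)) ^ k *
      (of_nat (card D) * harmonic_weight_enum (dual_code D) k f)
    = (- 2 * var_x * var_y) ^ k *
      (\<Sum>c\<in>D. const_xy (ftilde k f (supp UNIV c)) *
        (var_x + var_y) ^ (CARD('v) - wt UNIV c) * (var_x - var_y) ^ wt UNIV c)"
proof -
  define F where "F = (\<lambda>z. const_xy (f z))"
  have F_supp: "F z = 0" if "card z \<noteq> k" for z
    using h that by (auto simp: F_def harmonic_def RX_def ksubsets_def)
  have F_null: "(\<Sum>z | y \<subseteq> z. F z) = 0" if "card y < k" for y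
    using sum_supersets_harmonic[OF h that] by (simp add: F_def const_xy_sum[symmetric])
  have F_tilde: "const_xy (ftilde k f u) = (\<Sum>z\<in>Pow u. F z)" for u
    by (simp add: ftilde_eq_sum_Pow[OF h] const_xy_sum F_def)
  have "((var_x + var_y) * (var_x - var_y)) ^ k *
      (of_nat (card D) * harmonic_weight_enum (dual_code D) k f)
    = (\<Sum>c\<in>D. ((var_x + var_y) * (var_x - var_y)) ^ k *
        (\<Sum>z\<in>UNIV. F z * ((\<Prod>i\<in>z. bit_sign (c i) * var_y) *
          (\<Prod>i\<in>-z. bit_sign (c i) * var_y + var_x))))"
    unfolding harmonic_weight_enum_def F_tilde
    by (subst poisson_summation_dual_code[of D], rule add, assumption, assumption,
        subst signed_transform, rule sum_distrib_left)
  also have "\<dots> = (\<Sum>c\<in>D. (- 2 * var_x * var_y) ^ k *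
      (const_xy (ftilde k f (supp UNIV c)) *
        (var_x + var_y) ^ (CARD('v) - wt UNIV c) * (var_x - var_y) ^ wt UNIV c))"
    by (intro sum.cong refl, subst signed_transform_harmonic)
      (auto simp: F_supp F_null F_tilde mult.assoc)
  also have "\<dots> = (- 2 * var_x * var_y) ^ k *
      (\<Sum>c\<in>D. const_xy (ftilde k f (supp UNIV c)) *
        (var_x + var_y) ^ (CARD('v) - wt UNIV c) * (var_x - var_y) ^ wt UNIV c)"
    by (rule sum_distrib_left[symmetric])
  finally show ?thesis .
qed

section \<open>First-order Reed--Muller codes\<close>

lemma CARD_bit: "CARD(bit) = 2"
proof -
  have UNIV_bit: "(UNIV :: bit set) = {0, 1}" by (auto intro: bit.exhaust)
  show ?thesis unfolding UNIV_bit by simp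
qed

interpretation functional: vector_space_pair "(*s) :: bit \<Rightarrow> bit ^ 'm \<Rightarrow> bit ^ 'm" "(*)"
  by unfold_locales

lemma RM1_add:
  assumes "c \<in> RM1" "d \<in> RM1"
  shows "(\<lambda>x. c x + d x) \<in> RM1"
proof -
  obtain l b l' b' where "c = (\<lambda>x. l x + b)" "d = (\<lambda>x. l' x + b')"
    "Vector_Spaces.linear (*s) (*) l" "Vector_Spaces.linear (*s) (*) l'"
    using assms by (auto simp: RM1_def)
  then show ?thesis
    unfolding RM1_def using functional.linear_compose_add
    by (intro CollectI exI[of _ "\<lambda>x. l x + l' x"] exI[of _ "b + b'"])
      (auto simp: ac_simps)
qed

text \<open>Coefficient families on \<open>B\<close> correspond to the vectors of the span; taking
  them extensional makes the correspondence injective.\<close>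

lemma card_span_independent:
  fixes B :: "(bit ^ 'm) set"
  assumes "vec.independent B"
  shows "card (vec.span B) = 2 ^ card B"
proof -
  have "finite B" by simp
  have "bij_betw (\<lambda>u. \<Sum>v\<in>B. u v *s v) (B \<rightarrow>\<^sub>E UNIV) (vec.span B)"
  proof (rule bij_betw_imageI)
    show "inj_on (\<lambda>u. \<Sum>v\<in>B. u v *s v) (B \<rightarrow>\<^sub>E (UNIV :: bit set))"
    proof (rule inj_onI)
      fix u w :: "bit ^ 'm \<Rightarrow> bit"
      assume u: "u \<in> B \<rightarrow>\<^sub>E UNIV" and w: "w \<in> B \<rightarrow>\<^sub>E UNIV"
        and "(\<Sum>v\<in>B. u v *s v) = (\<Sum>v\<in>B. w v *s v)"
      then have diff: "(\<Sum>v\<in>B. (u v - w v) *s v) = 0"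
        by (simp add: vec.scale_left_diff_distrib sum_subtractf)
      have "u v = w v" if "v \<in> B" for v
        using vec.independentD[OF assms \<open>finite B\<close> subset_refl diff that] by simp
      then show "u = w"
        by (rule PiE_ext[OF u w])
    qed
    show "(\<lambda>u. \<Sum>v\<in>B. u v *s v) ` (B \<rightarrow>\<^sub>E UNIV) = vec.span B"
    proof
      show "(\<lambda>u. \<Sum>v\<in>B. u v *s v) ` (B \<rightarrow>\<^sub>E UNIV) \<subseteq> vec.span B"
        by (auto simp: vec.span_finite)
      show "vec.span B \<subseteq> (\<lambda>u. \<Sum>v\<in>B. u v *s v) ` (B \<rightarrow>\<^sub>E UNIV)"
      proof
        fix x assume "x \<in> vec.span B"
        then obtain u where "x = (\<Sum>v\<in>B. u v *s v)" by (auto simp: vec.span_finite)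
        then have "x = (\<Sum>v\<in>B. restrict u B v *s v)" by simp
        then show "x \<in> (\<lambda>u. \<Sum>v\<in>B. u v *s v) ` (B \<rightarrow>\<^sub>E UNIV)"
          by (intro image_eqI[of _ _ "restrict u B"]) simp_all
      qed
    qed
  qed
  then have "card (vec.span B) = card (B \<rightarrow>\<^sub>E (UNIV :: bit set))"
    by (rule bij_betw_same_card[symmetric])
  then show ?thesis by (simp add: card_PiE CARD_bit)
qed

text \<open>Linear parts vanish at 0, so the value at 0 is the additive constant; then the linear
  parts agree on \<open>B\<close> and hence on its span.\<close>

lemma RM1_eq_on_span:
  assumes "c \<in> RM1" "d \<in> RM1" "c 0 = d 0" "\<And>x. x \<in> B \<Longrightarrow> c x = d x" "x \<in> vec.span B"
  shows "c x = d x"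
proof -
  obtain l b l' b' where cd: "c = (\<lambda>x. l x + b)" "d = (\<lambda>x. l' x + b')"
    and l: "Vector_Spaces.linear (*s) (*) l" and l': "Vector_Spaces.linear (*s) (*) l'"
    using assms by (auto simp: RM1_def)
  have "b = b'"
    using assms(3) functional.linear_0[OF l] functional.linear_0[OF l'] by (simp add: cd)
  then have "l y = l' y" if "y \<in> B" for y
    using assms(4)[OF that] by (simp add: cd)
  then have "l x = l' x"
    by (rule functional.linear_eq_on[OF l l' assms(5)])
  then show ?thesis by (simp add: cd \<open>b = b'\<close>)
qed

text \<open>Extend \<open>B\<close> to a basis \<open>E\<close> of the whole space. An affine
  function is determined by its value at 0 and its values on \<open>E\<close>, and the values on
  \<open>E - B\<close> can be chosen freely.\<close>

lemma card_RM1_extensions: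
  fixes B :: "(bit ^ 'm) set"
  assumes B: "vec.independent B" and d: "d \<in> RM1"
  shows "card {c \<in> RM1. c 0 = d 0 \<and> (\<forall>x\<in>B. c x = d x)} = 2 ^ (CARD('m) - card B)"
proof -
  obtain E where E: "B \<subseteq> E" "vec.independent E" "UNIV \<subseteq> vec.span E"
    by (rule vec.maximal_independent_subset_extend[OF subset_UNIV B])
  have card_E: "card E = CARD('m)"
    using vec.basis_card_eq_dim[OF subset_UNIV E(3,2)] vec_dim_card[where 'a = bit and 'n = 'm]
    by metis
  let ?S = "{c \<in> RM1. c 0 = d 0 \<and> (\<forall>x\<in>B. c x = d x)}"
  have "bij_betw (\<lambda>c. restrict c (E - B)) ?S ((E - B) \<rightarrow>\<^sub>E UNIV)"
  proof (rule bij_betw_imageI)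
    show "inj_on (\<lambda>c. restrict c (E - B)) ?S"
    proof (rule inj_onI)
      fix c c' assume c: "c \<in> ?S" and c': "c' \<in> ?S"
        and eq: "restrict c (E - B) = restrict c' (E - B)"
      have "c x = c' x" if "x \<in> E" for x
        using c c' that fun_cong[OF eq, of x] by (cases "x \<in> B") auto
      then show "c = c'"
        using RM1_eq_on_span[of c c' E] c c' E(3) by (intro ext) auto
    qed
    show "(\<lambda>c. restrict c (E - B)) ` ?S = (E - B) \<rightarrow>\<^sub>E UNIV"
    proof
      show "(\<lambda>c. restrict c (E - B)) ` ?S \<subseteq> (E - B) \<rightarrow>\<^sub>E UNIV"
        by (intro image_subsetI PiE_I) (auto simp: restrict_def)
      show "(E - B) \<rightarrow>\<^sub>E UNIV \<subseteq> (\<lambda>c. restrict c (E - B)) ` ?S"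
      proof
        fix g :: "bit ^ 'm \<Rightarrow> bit" assume g: "g \<in> (E - B) \<rightarrow>\<^sub>E UNIV"
        \<comment> \<open>The linear part is prescribed with \<open>d 0\<close> added, so that
          adding \<open>d 0\<close> again gives the wanted values.\<close>
        obtain l where l: "Vector_Spaces.linear (*s) (*) l"
          and lE: "\<forall>x\<in>E. l x = (if x \<in> B then d x else g x) + d 0"
          using functional.linear_independent_extend[OF E(2),
              of "\<lambda>x. (if x \<in> B then d x else g x) + d 0"] by blast
        let ?c = "\<lambda>x. l x + d 0"
        have cE: "?c x = (if x \<in> B then d x else g x)" if "x \<in> E" for x
          using lE that by (simp add: add.assoc)
        have "?c \<in> RM1" using l by (auto simp: RM1_def)
        moreover have "?c 0 = d 0" using functional.linear_0[OF l] by simp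
        moreover have "\<forall>x\<in>B. ?c x = d x" using cE E(1) by (auto simp: subset_iff)
        ultimately have c: "?c \<in> ?S" by (intro CollectI conjI)
        have g_eq: "g = restrict ?c (E - B)"
        proof
          fix x show "g x = restrict ?c (E - B) x"
          proof (cases "x \<in> E - B")
            case True
            then show ?thesis using cE[of x] by simp
          next
            case False
            then show ?thesis using PiE_arb[OF g False] by (simp only: restrict_apply if_False)
          qed
        qed
        show "g \<in> (\<lambda>c. restrict c (E - B)) ` ?S"
          unfolding g_eq by (rule imageI[OF c])
      qed
    qed
  qed
  then have "card ?S = card ((E - B) \<rightarrow>\<^sub>E (UNIV :: bit set))"
    by (rule bij_betw_same_card)
  also have "\<dots> = 2 ^ card (E - B)" by (simp add: card_PiE CARD_bit)
  also have "card (E - B) = CARD('m) - card B"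
    using E(1) card_E by (simp add: card_Diff_subset)
  finally show ?thesis .
qed

lemma const_mem_RM1: "(\<lambda>_. b) \<in> RM1"
  unfolding RM1_def using functional.linear_zero
  by (intro CollectI exI[of _ "\<lambda>_. 0"] exI[of _ b]) auto

lemma card_RM1: "card (RM1 :: (bit ^ 'm \<Rightarrow> bit) set) = 2 ^ (CARD('m) + 1)"
proof -
  have card: "card {c \<in> RM1. (c :: bit ^ 'm \<Rightarrow> bit) 0 = b} = 2 ^ CARD('m)" for b
    using card_RM1_extensions[OF vec.independent_empty const_mem_RM1[of b]] by simp
  have "(RM1 :: (bit ^ 'm \<Rightarrow> bit) set) = {c \<in> RM1. c 0 = 0} \<union> {c \<in> RM1. c 0 = 1}"
    by auto
  then have "card (RM1 :: (bit ^ 'm \<Rightarrow> bit) set)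
      = card ({c \<in> RM1. (c :: bit ^ 'm \<Rightarrow> bit) 0 = 0} \<union> {c \<in> RM1. c 0 = 1})"
    by simp
  also have "\<dots> = 2 ^ CARD('m) + 2 ^ CARD('m)"
    by (subst card_Un_disjoint) (auto simp: card simp del: bit_not_zero_iff)
  finally show ?thesis by simp
qed

text \<open>Restrictions to \<open>U\<close> agree exactly when the words agree at 0 and on a basis
  of \<open>U\<close>, so this is an extension count.\<close>

lemma card_RM1_fibre:
  fixes U :: "(bit ^ 'm) set"
  assumes U: "vec.subspace U" and d: "d \<in> RM1"
  shows "card {c \<in> RM1. restrict c U = restrict d U} = 2 ^ (CARD('m) - vec.dim U)"
proof -
  obtain B where B: "B \<subseteq> U" "vec.independent B" "U \<subseteq> vec.span B" "card B = vec.dim U"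
    by (rule vec.basis_exists)
  have "restrict c U = restrict d U \<longleftrightarrow> c 0 = d 0 \<and> (\<forall>x\<in>B. c x = d x)" if "c \<in> RM1" for c
  proof
    assume "restrict c U = restrict d U"
    then have "c x = d x" if "x \<in> U" for x
      using that by (metis restrict_apply')
    then show "c 0 = d 0 \<and> (\<forall>x\<in>B. c x = d x)"
      using B(1) vec.subspace_0[OF U] by auto
  next
    assume "c 0 = d 0 \<and> (\<forall>x\<in>B. c x = d x)"
    then show "restrict c U = restrict d U"
      using RM1_eq_on_span[OF that d] B(3) by (intro restrict_ext) blast
  qed
  then have "{c \<in> RM1. restrict c U = restrict d U}
      = {c \<in> RM1. c 0 = d 0 \<and> (\<forall>x\<in>B. c x = d x)}" by auto
  then show ?thesis
    using card_RM1_extensions[OF B(2) d] B(4) by simp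
qed

lemma card_subspace_bit:
  fixes U :: "(bit ^ 'm) set"
  assumes "vec.subspace U"
  shows "card U = 2 ^ vec.dim U"
proof -
  obtain B where B: "B \<subseteq> U" "vec.independent B" "U \<subseteq> vec.span B" "card B = vec.dim U"
    by (rule vec.basis_exists)
  then have "U = vec.span B"
    using vec.span_minimal[OF B(1) assms] by auto
  then show ?thesis using card_span_independent[OF B(2)] B(4) by simp
qed

text \<open>Translation by \<open>u\<close> with \<open>l u = 1\<close> exchanges the zeros and the ones of \<open>c = l + b\<close> on \<open>U\<close>.\<close>

lemma RM1_supp_cases:
  assumes U: "vec.subspace U" and c: "c \<in> RM1"
  obtains "supp U c = {}" | "supp U c = U" | "2 * wt U c = card U"
proof -
  obtain l b where cl: "c = (\<lambda>x. l x + b)" and l: "Vector_Spaces.linear (*s) (*) l"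
    using c by (auto simp: RM1_def)
  show thesis
  proof (cases "\<exists>u\<in>U. l u = 1")
    case False
    then have "\<forall>u\<in>U. l u = 0" by auto
    then have "supp U c = {} \<or> supp U c = U"
      by (cases b) (auto simp: supp_def cl)
    then show ?thesis using that by blast
  next
    case True
    then obtain u where u: "u \<in> U" "l u = 1" by auto
    have add_self: "x + u + u = x" for x
    proof -
      have "u + u = 0" by (simp add: vec_eq_iff)
      then show ?thesis by (simp add: add.assoc)
    qed
    have flip: "c (x + u) = c x + 1" for x
      using functional.linear_add[OF l, of x u] u by (simp add: cl ac_simps)
    have "bij_betw (\<lambda>x. x + u) (supp U c) (U - supp U c)"
      by (rule bij_betwI[where g = "\<lambda>x. x + u"])
        (use u vec.subspace_add[OF U] flip add_self in \<open>auto simp: supp_def\<close>)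
    then have "card (supp U c) = card (U - supp U c)"
      by (rule bij_betw_same_card)
    also have "\<dots> = card U - card (supp U c)"
      by (intro card_Diff_subset) (auto simp: supp_def)
    finally have "2 * wt U c = card U"
      using card_mono[of U "supp U c"] by (auto simp: wt_def supp_def)
    then show ?thesis using that by blast
  qed
qed

section \<open>The harmonic weight enumerators of \<open>RM(1,m)\<close> and of its dual\<close>

theorem theorem1p2:
  fixes m k :: nat
    and C H8 :: "(bit ^ 'm \<Rightarrow> bit) set"
    and U :: "(bit ^ 'm) set"
    and f :: "(bit ^ 'm) set \<Rightarrow> real"
  assumes "m = CARD('m)" and "m \<ge> 3"
    and "C = RM1"
    and "vec.subspace U" and "vec.dim U = 3"
    and "H8 = restrict_code U C"
    and "k > 0"
    and "harmonic k f"
    and "\<And>z. z \<in> ksubsets k \<Longrightarrow> \<not> z \<subseteq> U \<Longrightarrow> f z = 0"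
  shows "harmonic_weight_enum C k f =
      2 ^ (m - 3) * var_x ^ (2 ^ (m - 1)) * var_y ^ (2 ^ (m - 1)) *
      const_xy (\<Sum>a \<in> {a \<in> H8. wt U a = 4}. ftilde k f (supp U a)) \<and>
    harmonic_weight_enum (dual_code C) k f =
      (- 1) ^ k * (var_x * var_y) ^ k * 2 ^ (2 ^ (m - 1) - 4) *
      (const_xy (1 / sqrt 2) * (var_x + var_y)) ^ (2 ^ (m - 1) - k) *
      (const_xy (1 / sqrt 2) * (var_x - var_y)) ^ (2 ^ (m - 1) - k) *
      const_xy (\<Sum>a \<in> {a \<in> H8. wt U a = 4}. ftilde k f (supp U a))"
proof -
  define S where "S = (\<Sum>a \<in> {a \<in> H8. wt U a = 4}. ftilde k f (supp U a))"
  \<comment> \<open>Half the length, hence the weight of every nonconstant word.\<close>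
  define N :: nat where "N = 2 ^ (m - 1)"
  have CARD_V: "CARD(bit ^ 'm) = 2 * N"
    using assms(1,2) by (simp add: CARD_vec CARD_bit N_def power_Suc[symmetric] del: power_Suc)
  have card_U: "card U = 8"
    using card_subspace_bit[OF assms(4)] assms(5) by simp
  have wt_N: "wt UNIV c = N" if c: "c \<in> C" and nz: "ftilde k f (supp UNIV c) \<noteq> 0" for c
  proof -
    have "c \<in> RM1" using c assms(3) by simp
    then show ?thesis
      by (rule RM1_supp_cases[OF vec.subspace_UNIV])
        (use nz ftilde_empty[OF assms(7)] ftilde_UNIV[OF assms(8,7)] CARD_V in auto)
  qed
  have tilde_restrict: "ftilde k f (supp UNIV c) = ftilde k f (supp U (restrict c U))" for c
  proof -
    have "supp U (restrict c U) = supp UNIV c \<inter> U" by (auto simp: supp_def)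
    then show ?thesis using ftilde_inter[of k U f, OF assms(9)] by simp
  qed
  \<comment> \<open>The words are grouped by their restriction to \<open>U\<close>; each fibre has
    \<open>2 ^ (m - 3)\<close> members, all with the same value of \<open>ftilde\<close>.\<close>
  have sum_C: "(\<Sum>c\<in>C. ftilde k f (supp UNIV c)) = 2 ^ (m - 3) * S"
  proof -
    have "(\<Sum>c\<in>C. ftilde k f (supp UNIV c))
        = (\<Sum>a\<in>H8. \<Sum>c | c \<in> C \<and> restrict c U = a. ftilde k f (supp UNIV c))"
      using assms(6) by (intro sum.group[symmetric]) (auto simp: restrict_code_def)
    also have "\<dots> = (\<Sum>a\<in>H8. 2 ^ (m - 3) * ftilde k f (supp U a))"
    proof (intro sum.cong refl)
      fix a assume "a \<in> H8"
      then obtain d where d: "d \<in> RM1" "a = restrict d U"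
        using assms(3,6) by (auto simp: restrict_code_def)
      have "(\<Sum>c | c \<in> C \<and> restrict c U = a. ftilde k f (supp UNIV c))
          = (\<Sum>c | c \<in> C \<and> restrict c U = a. ftilde k f (supp U a))"
        by (intro sum.cong) (auto simp: tilde_restrict)
      also have "\<dots> = 2 ^ (m - 3) * ftilde k f (supp U a)"
        using card_RM1_fibre[OF assms(4) d(1)] assms(1,3,5) by (simp add: d(2))
      finally show "(\<Sum>c | c \<in> C \<and> restrict c U = a. ftilde k f (supp UNIV c))
          = 2 ^ (m - 3) * ftilde k f (supp U a)" .
    qed
    also have "\<dots> = 2 ^ (m - 3) * (\<Sum>a\<in>H8. ftilde k f (supp U a))"
      by (simp add: sum_distrib_left)
    \<comment> \<open>Apart from the words of weight 4 = 8/2, \<open>H8\<close> holds only those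
      with support empty or \<open>U\<close>. Both have \<open>ftilde\<close> zero, the second
      because \<open>ftilde\<close> takes the same value at \<open>U\<close> as at the whole
      space.\<close>
    also have "(\<Sum>a\<in>H8. ftilde k f (supp U a)) = S"
      unfolding S_def
    proof (rule sum.mono_neutral_right; (auto; fail)?)
      show "\<forall>a\<in>H8 - {a \<in> H8. wt U a = 4}. ftilde k f (supp U a) = 0"
      proof
        fix a assume a: "a \<in> H8 - {a \<in> H8. wt U a = 4}"
        then obtain d where d: "d \<in> RM1" "a = restrict d U"
          using assms(3,6) by (auto simp: restrict_code_def)
        have supp_a: "supp U a = supp U d" by (auto simp: supp_def d(2))
        have U0: "ftilde k f U = 0"
          using ftilde_inter[of k U f UNIV, OF assms(9)] ftilde_UNIV[OF assms(8,7)] by simp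
        show "ftilde k f (supp U a) = 0"
          using RM1_supp_cases[OF assms(4) d(1)]
          by cases (use a U0 ftilde_empty[OF assms(7)] card_U supp_a in \<open>auto simp: wt_def\<close>)
      qed
    qed
    finally show ?thesis .
  qed

  have first: "harmonic_weight_enum C k f
      = 2 ^ (m - 3) * var_x ^ N * var_y ^ N * const_xy S"
  proof -
    have "harmonic_weight_enum C k f
        = (\<Sum>c\<in>C. const_xy (ftilde k f (supp UNIV c)) * (var_x ^ N * var_y ^ N))"
      unfolding harmonic_weight_enum_def
    proof (intro sum.cong refl)
      fix c assume "c \<in> C"
      then show "const_xy (ftilde k f (supp UNIV c)) *
          var_x ^ (CARD(bit ^ 'm) - wt UNIV c) * var_y ^ wt UNIV c
        = const_xy (ftilde k f (supp UNIV c)) * (var_x ^ N * var_y ^ N)"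
        using wt_N[of c] CARD_V
        by (cases "ftilde k f (supp UNIV c) = 0") (simp_all add: mult.assoc)
    qed
    also have "\<dots> = const_xy (\<Sum>c\<in>C. ftilde k f (supp UNIV c)) * (var_x ^ N * var_y ^ N)"
      by (simp add: const_xy_sum sum_distrib_right)
    finally show ?thesis
      unfolding sum_C by (simp add: const_xy_mult const_xy_power const_xy_numeral ac_simps)
  qed

  let ?q = "(var_x + var_y) * (var_x - var_y)"
  have q_nz: "?q \<noteq> 0"
    by (auto simp: var_x_def var_y_def)
  have two_nz: "(2 :: real poly poly) \<noteq> 0" by simp
  \<comment> \<open>In the MacWilliams identity only words of weight \<open>N\<close> in length
    \<open>2 * N\<close> count, so each contributes a multiple of \<open>?q ^ N\<close>.\<close>
  have dual: "?q ^ k * (2 ^ (m + 1) * harmonic_weight_enum (dual_code C) k f)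
      = (- 2 * var_x * var_y) ^ k * (?q ^ N * (2 ^ (m - 3) * const_xy S))"
  proof -
    have "(\<Sum>c\<in>C. const_xy (ftilde k f (supp UNIV c)) *
          (var_x + var_y) ^ (CARD(bit ^ 'm) - wt UNIV c) * (var_x - var_y) ^ wt UNIV c)
        = (\<Sum>c\<in>C. const_xy (ftilde k f (supp UNIV c)) * ?q ^ N)"
    proof (intro sum.cong refl)
      fix c assume "c \<in> C"
      then show "const_xy (ftilde k f (supp UNIV c)) *
          (var_x + var_y) ^ (CARD(bit ^ 'm) - wt UNIV c) * (var_x - var_y) ^ wt UNIV c
        = const_xy (ftilde k f (supp UNIV c)) * ?q ^ N"
        using wt_N[of c] CARD_V
        by (cases "ftilde k f (supp UNIV c) = 0") (simp_all add: mult.assoc power_mult_distrib)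
    qed
    also have "\<dots> = const_xy (\<Sum>c\<in>C. ftilde k f (supp UNIV c)) * ?q ^ N"
      by (simp add: const_xy_sum sum_distrib_right)
    also have "\<dots> = ?q ^ N * (2 ^ (m - 3) * const_xy S)"
      unfolding sum_C by (simp add: const_xy_mult const_xy_power const_xy_numeral ac_simps)
    finally have sum_eq: "(\<Sum>c\<in>C. const_xy (ftilde k f (supp UNIV c)) *
          (var_x + var_y) ^ (CARD(bit ^ 'm) - wt UNIV c) * (var_x - var_y) ^ wt UNIV c)
        = ?q ^ N * (2 ^ (m - 3) * const_xy S)" .
    have card_C: "of_nat (card C) = (2 ^ (m + 1) :: real poly poly)"
      using card_RM1[where 'm = 'm] assms(1,3) by simp
    have "\<And>c d. c \<in> C \<Longrightarrow> d \<in> C \<Longrightarrow> (\<lambda>x. c x + d x) \<in> C"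
      using RM1_add assms(3) by blast
    from macwilliams_harmonic[of C, OF this assms(8)] show ?thesis
      unfolding sum_eq card_C .
  qed

  have second: "harmonic_weight_enum (dual_code C) k f =
      (- 1) ^ k * (var_x * var_y) ^ k * 2 ^ (N - 4) *
      (const_xy (1 / sqrt 2) * (var_x + var_y)) ^ (N - k) *
      (const_xy (1 / sqrt 2) * (var_x - var_y)) ^ (N - k) * const_xy S"
  proof (cases "k \<le> N")
    \<comment> \<open>For \<open>k > N\<close> a word of weight \<open>N\<close> cannot contain a
      \<open>k\<close>-set, so every value of \<open>ftilde\<close> on \<open>C\<close> vanishes.
      Hence \<open>S = 0\<close>, and both sides are zero whatever the truncated exponent
      \<open>N - k\<close> is.\<close>
    case False
    have "ftilde k f (supp UNIV c) = 0" if "c \<in> C" for c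
      using wt_N[OF that] ftilde_card_less[of "supp UNIV c" k f] False
      by (cases "ftilde k f (supp UNIV c) = 0") (auto simp: wt_def)
    then have "S = 0" using sum_C by simp
    then show ?thesis using dual q_nz by simp
  next
    case True
    \<comment> \<open>Ensures that the exponent \<open>N - 4\<close> is not truncated.\<close>
    have N4: "N \<ge> 4"
      using power_increasing[of 2 "m - 1" "2::nat"] assms(2) by (simp add: N_def)
    let ?h = "const_xy (1 / sqrt 2)"
    have half: "2 * (?h * ?h) = 1"
    proof -
      have "2 * (?h * ?h) = const_xy (2 * (1 / sqrt 2 * (1 / sqrt 2)))"
        by (simp only: const_xy_mult const_xy_numeral)
      also have "2 * (1 / sqrt 2 * (1 / sqrt 2)) = (1 :: real)" by simp
      finally show ?thesis by simp
    qed
    \<comment> \<open>Each of the \<open>N - k\<close> pairs of factors \<open>1 / sqrt 2\<close>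
      absorbs one 2, which leaves the \<open>2 ^ k\<close> of
      \<open>(- 2 * var_x * var_y) ^ k\<close>.\<close>
    have "2 ^ 4 * 2 ^ (N - 4) * (?h * ?h) ^ (N - k) = 2 ^ N * (?h * ?h) ^ (N - k)"
      using N4 by (simp only: power_add[symmetric]) simp
    also have "\<dots> = 2 ^ k * (2 * (?h * ?h)) ^ (N - k)"
    proof -
      have "(2 :: real poly poly) ^ N = 2 ^ k * 2 ^ (N - k)"
        using True by (simp only: power_add[symmetric]) simp
      then show ?thesis by (simp only: power_mult_distrib mult.assoc)
    qed
    finally have pow2: "2 ^ 4 * 2 ^ (N - 4) * (?h * ?h) ^ (N - k) = 2 ^ k"
      by (simp only: half power_one mult_1_right)
    let ?R = "(- 1) ^ k * (var_x * var_y) ^ k * 2 ^ (N - 4) *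
      (?h * (var_x + var_y)) ^ (N - k) * (?h * (var_x - var_y)) ^ (N - k) * const_xy S"
    \<comment> \<open>Multiplied by \<open>?q ^ k * 2 ^ (m + 1)\<close>, the claimed value
      \<open>?R\<close> becomes the right-hand side of \<open>dual\<close>, and the nonzero factor
      cancels. The \<open>2 ^ 4\<close> comes from \<open>m + 1 = (m - 3) + 4\<close>.\<close>
    have "?q ^ k * (2 ^ (m + 1) * ?R) = 2 ^ (m - 3) * (2 ^ 4 * 2 ^ (N - 4) * (?h * ?h) ^ (N - k)) *
        (- 1) ^ k * (var_x * var_y) ^ k * (?q ^ k * ?q ^ (N - k)) * const_xy S"
    proof -
      have "(2 :: real poly poly) ^ (m + 1) = 2 ^ (m - 3) * 2 ^ 4"
        using assms(2) by (simp only: power_add[symmetric]) simp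
      then show ?thesis by (simp only: power_mult_distrib ac_simps)
    qed
    also have "?q ^ k * ?q ^ (N - k) = ?q ^ N"
      using True by (simp only: power_add[symmetric]) simp
    also have "2 ^ (m - 3) * (2 ^ 4 * 2 ^ (N - 4) * (?h * ?h) ^ (N - k)) *
        (- 1) ^ k * (var_x * var_y) ^ k * ?q ^ N * const_xy S
      = (- 2 * var_x * var_y) ^ k * (?q ^ N * (2 ^ (m - 3) * const_xy S))"
    proof -
      have "(- 2 * var_x * var_y) ^ k = (- 1) ^ k * 2 ^ k * (var_x * var_y) ^ k"
        by (simp only: power_mult_distrib[symmetric]) (simp add: mult.assoc)
      then show ?thesis unfolding pow2 by (simp only: ac_simps)
    qed
    also have "\<dots> = ?q ^ k * (2 ^ (m + 1) * harmonic_weight_enum (dual_code C) k f)"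
      by (rule dual[symmetric])
    finally show ?thesis using q_nz two_nz by simp
  qed
  show ?thesis
    using first second unfolding N_def S_def by simp
qed

end
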